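(* Let $E$ be a Euclidean simple Jordan algebra with identity $e$, let $\Omega$ be the associated irreducible symmetric cone, of rank $r$, and let $\mathcal{D}=\{x\in\Omega : e-x\in\Omega\}$. Let $w$ be a multiplication algorithm on $\Omega$ which is homogeneous of degree $1$, i.e. $w(sx)=s\,w(x)$ for all $s>0$, $x\in\Omega$, and let $g=w^{-1}$ (i.e. $g(x)=w(x)^{-1}$ in $G$ for every $x\in\Omega$). Let $a,b,c,d$ be real continuous functions on $\Omega$ such that $$a(x)+b(y)=c(x+y)+d\big(g(x+y)x\big),\qquad (x,y)\in\Omega^2.$$ Then there exist constants $C_1,C_2,C_3,C_4\in\mathbb{R}$ with $C_1+C_2=C_3+C_4$, an element $\Lambda\in E$, and continuous $w$-logarithmic Cauchy functions $e_0,f_0\colon\Omega\to\mathbb{R}$ such that for all $x\in\Omega$ and $u\in\mathcal{D}$: $$a(x)=\langle\Lambda,x\rangle+e_0(x)+C_1,\quad b(x)=\langle\Lambda,x\rangle+f_0(x)+C_2,\quad c(x)=\langle\Lambda,x\rangle+e_0(x)+f_0(x)+C_3,$$ $$d(u)=e_0(w(e)u)+f_0(e-w(e)u)+C_4.$$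
   Context: A Euclidean Jordan algebra is a finite-dimensional real inner product space $(E,\langle\cdot,\cdot\rangle)$ with a bilinear product $(x,y)\mapsto xy$ and unit $e$ such that $xy=yx$, $x(x^2y)=x^2(xy)$, $xe=x$, and $\langle x,yz\rangle=\langle xy,z\rangle$; it is simple if it is not a Cartesian product of two Euclidean Jordan algebras of positive dimension. The symmetric cone $\Omega$ is the interior of $\{x^2: x\in E\}$; the rank $r$ is the size of any complete system of primitive orthogonal idempotents. $G$ denotes the connected component containing the identity of the group of linear automorphisms of $E$ preserving $\Omega$. A multiplication algorithm is a map $\Omega\to G$, $x\mapsto w(x)$, with $w(x)e=x$ for all $x\in\Omega$. A function $h\colon\Omega\to\mathbb{R}$ is a $w$-logarithmic Cauchy function if $h(x)+h(w(e)y)=h(w(x)y)$ for all $(x,y)\in\Omega^2$. *)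

theory Defs
  imports "HOL-Analysis.Analysis"
begin

definition euclidean_jordan_algebra :: "('a::euclidean_space \<Rightarrow> 'a \<Rightarrow> 'a) \<Rightarrow> 'a \<Rightarrow> bool" where
  "euclidean_jordan_algebra m e \<longleftrightarrow>
     bilinear m \<and>
     (\<forall>x y. m x y = m y x) \<and>
     (\<forall>x y. m x (m (m x x) y) = m (m x x) (m x y)) \<and>
     (\<forall>x. m x e = x) \<and>
     (\<forall>x y z. inner x (m y z) = inner (m x y) z)"

text \<open>Not simple: E is (internally) the Cartesian product of two nonzero subalgebras
A, B (A + B = E, A \<inter> B = 0, A B = 0).\<close>
definition simple_eja :: "('a::euclidean_space \<Rightarrow> 'a \<Rightarrow> 'a) \<Rightarrow> 'a \<Rightarrow> bool" where
  "simple_eja m e \<longleftrightarrow> euclidean_jordan_algebra m e \<and>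
     \<not> (\<exists>A B. subspace A \<and> subspace B \<and> A \<noteq> {0} \<and> B \<noteq> {0} \<and>
            A \<inter> B = {0} \<and> (\<forall>x. \<exists>a\<in>A. \<exists>b\<in>B. x = a + b) \<and>
            (\<forall>a\<in>A. \<forall>a'\<in>A. m a a' \<in> A) \<and> (\<forall>b\<in>B. \<forall>b'\<in>B. m b b' \<in> B) \<and>
            (\<forall>a\<in>A. \<forall>b\<in>B. m a b = 0))"

definition sym_cone :: "('a::euclidean_space \<Rightarrow> 'a \<Rightarrow> 'a) \<Rightarrow> 'a set" where
  "sym_cone m = interior {m x x | x. True}"

text \<open>Group G: identity component of the group of linear automorphisms preserving the cone
(topology of pointwise convergence, which equals the norm topology on linear maps here).\<close>
definition cone_aut :: "('a::euclidean_space \<Rightarrow> 'a \<Rightarrow> 'a) \<Rightarrow> ('a \<Rightarrow> 'a) set" where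
  "cone_aut m = {f. linear f \<and> bij f \<and> f ` sym_cone m = sym_cone m}"

definition cone_group :: "('a::euclidean_space \<Rightarrow> 'a \<Rightarrow> 'a) \<Rightarrow> ('a \<Rightarrow> 'a) set" where
  "cone_group m = connected_component_set (cone_aut m) id"

definition multiplication_algorithm ::
  "('a::euclidean_space \<Rightarrow> 'a \<Rightarrow> 'a) \<Rightarrow> 'a \<Rightarrow> ('a \<Rightarrow> 'a \<Rightarrow> 'a) \<Rightarrow> bool" where
  "multiplication_algorithm m e w \<longleftrightarrow>
     (\<forall>x\<in>sym_cone m. w x \<in> cone_group m \<and> w x e = x)"

definition w_log_cauchy ::
  "('a::euclidean_space \<Rightarrow> 'a \<Rightarrow> 'a) \<Rightarrow> 'a \<Rightarrow> ('a \<Rightarrow> 'a \<Rightarrow> 'a) \<Rightarrow> ('a \<Rightarrow> real) \<Rightarrow> bool" where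
  "w_log_cauchy m e w h \<longleftrightarrow>
     (\<forall>x\<in>sym_cone m. \<forall>y\<in>sym_cone m. h x + h (w e y) = h (w x y))"

end

theory Submission
  imports Defs
begin

text \<open>Replacing \<open>(x, y)\<close> by \<open>(s x, s y)\<close> leaves \<open>d (g (x + y) x)\<close> unchanged, because \<open>w\<close> is
  homogeneous. Hence the increments \<open>a (s x) - a x\<close>, \<open>b (s x) - b x\<close>, \<open>c (s x) - c x\<close> solve the
  additive Pexider equation on the convex cone \<open>\<Omega>\<close>, which forces
  \<open>a (s x) = a x + (s - 1) \<langle>\<Lambda>, x\<rangle> + A s\<close>, and likewise for \<open>b\<close> and \<open>c\<close> with the same \<open>\<Lambda>\<close>.
  After subtracting \<open>\<langle>\<Lambda>, x\<rangle>\<close>, the equation at \<open>(w z (s v), z - w z (s v))\<close> has the right-hand side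
  \<open>c z + d (s v)\<close>; comparing it with the case \<open>z = e\<close>, the terms \<open>A s\<close> cancel, and \<open>s \<rightarrow> 0\<close> gives
  \<open>a (w z v) + b z - c z = a (w e v) + b e - c e\<close>, which contains the logarithmic Cauchy equation.

  Convexity of \<open>\<Omega>\<close> follows by identifying it with the interior of the cone of those \<open>y\<close> for
  which multiplication by \<open>y\<close> is positive semidefinite.\<close>

subsection \<open>The symmetric cone of a Euclidean Jordan algebra\<close>

locale eja =
  fixes m :: "'a::euclidean_space \<Rightarrow> 'a \<Rightarrow> 'a" and e :: 'a
  assumes eja: "euclidean_jordan_algebra m e"
begin

lemma bil: "bilinear m"
  and comm: "m x y = m y x"
  and jordan: "m x (m (m x x) y) = m (m x x) (m x y)"
  and unit_right [simp]: "m x e = x"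
  and assoc_inner: "inner x (m y z) = inner (m x y) z"
  using eja unfolding euclidean_jordan_algebra_def by auto

lemma unit_left [simp]: "m e x = x"
  using comm[of e x] by simp

lemma inner_mult_sym: "inner (m x y) z = inner y (m x z)"
  using assoc_inner[of y x z] by (simp add: comm[of x y])

lemmas mult_distribs = bilinear_ladd[OF bil] bilinear_radd[OF bil] bilinear_lsub[OF bil]
  bilinear_rsub[OF bil] bilinear_lmul[OF bil] bilinear_rmul[OF bil]

lemmas zero [simp] = bilinear_lzero[OF bil] bilinear_rzero[OF bil]

lemma unit_nonzero: "e \<noteq> 0"
proof
  assume "e = 0"
  then have "x = 0" for x :: 'a
    using unit_right[of x] by simp
  then show False
    using nonzero_Basis[OF SOME_Basis, where 'a = 'a] by blast
qed

lemma linear_mult: "linear (m x)"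
  using bil by (simp add: bilinear_def)

lemma norm_mult_bound: obtains B where "B > 0" "\<And>x y. norm (m x y) \<le> B * norm x * norm y"
  using bilinear_bounded_pos[OF bil] that by blast

lemma continuous_on_mult:
  "continuous_on S f \<Longrightarrow> continuous_on S g \<Longrightarrow> continuous_on S (\<lambda>x. m (f x) (g x))"
  using bounded_bilinear.continuous_on bil unfolding bilinear_conv_bounded_bilinear by blast

section \<open>Linearized Jordan identity and power associativity\<close>

lemma jordan_polarized:
  "m x (m (m y z) u) + m y (m (m z x) u) + m z (m (m x y) u)
   = m (m y z) (m x u) + m (m z x) (m y u) + m (m x y) (m z u)"
proof -
  \<comment> \<open>The defect of the Jordan identity: trilinear, symmetric in its last two
    arguments, and zero on the diagonal. Polarizing this cubic form twice yields the claim.\<close>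
  define T where "T p q r = m p (m (m q r) u) - m (m q r) (m p u)" for p q r
  have T_diag: "T p p p = 0" for p
    by (simp add: T_def jordan)
  have T_add: "T (p + p') q r = T p q r + T p' q r" "T p (q + p') r = T p q r + T p p' r"
    "T p q (r + p') = T p q r + T p q p'" for p q r p'
    by (simp_all add: T_def mult_distribs)
  have T_minus: "T (- p) q r = - T p q r" "T p (- q) r = - T p q r" "T p q (- r) = - T p q r" for p q r
    by (simp_all add: T_def bilinear_lneg[OF bil] bilinear_rneg[OF bil])
  have T_comm: "T p q r = T p r q" for p q r
    by (simp add: T_def comm[of q r])
  \<comment> \<open>In the expansions of the diagonal values at \<open>p + q\<close> and
    \<open>p - q\<close>, the difference keeps the terms of odd degree in \<open>q\<close>. Removing
    the cubic one leaves the part linear in \<open>q\<close>.\<close>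
  have E: "T q p p + 2 *\<^sub>R T p p q = 0" for p q
  proof -
    have "T (p + q) (p + q) (p + q) - T (p + - q) (p + - q) (p + - q) - 2 *\<^sub>R T q q q
        = 2 *\<^sub>R (T q p p + 2 *\<^sub>R T p p q)"
      by (simp only: T_add T_minus T_comm[of p q p] scaleR_2) simp
    then show ?thesis
      by (simp only: T_diag) simp
  qed
  \<comment> \<open>Second polarization: \<open>E\<close> with \<open>q = y\<close>, now at
    \<open>p = x + z\<close>, minus its instances at \<open>p = x\<close> and
    \<open>p = z\<close>.\<close>
  have "T y (x + z) (x + z) + 2 *\<^sub>R T (x + z) (x + z) y - (T y x x + 2 *\<^sub>R T x x y)
      - (T y z z + 2 *\<^sub>R T z z y) = 2 *\<^sub>R (T x y z + T y z x + T z x y)"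
    by (simp only: T_add T_comm[of y x z] T_comm[of x z y] scaleR_2) simp
  then have "T x y z + T y z x + T z x y = 0"
    by (simp only: E) simp
  then show ?thesis
    by (simp add: T_def algebra_simps)
qed

text \<open>This is \<open>jordan_polarized\<close> with \<open>u = x\<close>. Read as an identity
  between operators acting on \<open>y\<close>, it expresses multiplication by
  \<open>m x (m x z)\<close> through multiplications by \<open>x\<close>, \<open>m x x\<close>,
  \<open>z\<close> and \<open>m x z\<close>, which drives the induction over powers of
  \<open>x\<close>.\<close>

lemma mult_power_step:
  "m (m x (m x z)) y = m (m x x) (m z y) + 2 *\<^sub>R m (m x z) (m x y)
     - m x (m x (m z y)) - m z (m x (m x y))"
proof -
  have "m (m (m z x) x) y = m (m x x) (m y z) + m (m z x) (m y x) + m (m x y) (m z x)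
      - m x (m (m y z) x) - m z (m (m x y) x)"
    using jordan_polarized[of x y z x] by (simp add: comm[of y "m (m z x) x"] comm[of "m x x"] algebra_simps)
  then show ?thesis
    unfolding scaleR_2
    by (simp add: comm[of z x] comm[of y x] comm[of y z] comm[of "m z y" x] comm[of "m x y" x]
        comm[of "m x z" x] comm[of "m x y" "m x z"])
qed

definition jpow :: "'a \<Rightarrow> nat \<Rightarrow> 'a" where
  "jpow x n = (m x ^^ n) e"

lemma jpow_0 [simp]: "jpow x 0 = e"
  and jpow_Suc [simp]: "jpow x (Suc n) = m x (jpow x n)"
  by (simp_all add: jpow_def)

text \<open>By \<open>mult_power_step\<close>, multiplication by a power is a polynomial in
  multiplications by \<open>x\<close>, \<open>m x x\<close> and the two preceding powers, so
  commuting with the first two operators propagates to all powers.\<close>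

lemma commutes_with_jpow:
  assumes T: "linear T" and T1: "\<And>y. T (m x y) = m x (T y)"
    and T2: "\<And>y. T (m (m x x) y) = m (m x x) (T y)"
  shows "T (m (jpow x n) y) = m (jpow x n) (T y)"
proof (induction n arbitrary: y rule: less_induct)
  case (less n)
  interpret T: linear T by fact
  show ?case
  proof (cases n)
    case (Suc k)
    show ?thesis
    proof (cases k)
      case (Suc l)
      have IH: "T (m (jpow x l) y) = m (jpow x l) (T y)"
        "T (m (m x (jpow x l)) y) = m (m x (jpow x l)) (T y)" for y
        using less[of l] less[of "Suc l"] \<open>n = Suc k\<close> Suc by simp_all
      show ?thesis
      proof -
        define z where "z = jpow x l"
        have n: "jpow x n = m x (m x z)"
          by (simp add: z_def \<open>n = Suc k\<close> Suc)
        have IHz: "T (m z y) = m z (T y)" "T (m (m x z) y) = m (m x z) (T y)" for y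
          using IH by (simp_all only: z_def)
        show ?thesis
          unfolding n mult_power_step[of x z]
          by (simp only: T.diff T.add T.scaleR IHz T1 T2)
      qed
    qed (simp add: T1 \<open>n = Suc k\<close>)
  qed simp
qed

lemma jpow_commute: "m (jpow x k) (m (jpow x n) y) = m (jpow x n) (m (jpow x k) y)"
\<comment> \<open>The lemma is applied twice: first to multiplication by \<open>x\<close> and by
  \<open>m x x\<close>, then to multiplication by \<open>jpow x k\<close>, which the first use shows
  to be admissible.\<close>
proof (rule commutes_with_jpow)
  show "m (jpow x k) (m x y) = m x (m (jpow x k) y)" for y
    using commutes_with_jpow[of "m x" x k y] by (simp add: linear_mult jordan)
  show "m (jpow x k) (m (m x x) y) = m (m x x) (m (jpow x k) y)" for y
    using commutes_with_jpow[of "m (m x x)" x k y] by (simp add: linear_mult jordan)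
qed (rule linear_mult)

lemma jpow_add: "m (jpow x k) (jpow x n) = jpow x (k + n)"
proof (induction n)
  case (Suc n)
  then show ?case
    using jpow_commute[of x k "Suc 0" "jpow x n"] by simp
qed simp

definition assoc_subalgebra :: "'a set \<Rightarrow> bool" where
  "assoc_subalgebra A \<longleftrightarrow> subspace A \<and> e \<in> A \<and> (\<forall>a\<in>A. \<forall>b\<in>A. m a b \<in> A) \<and>
     (\<forall>a\<in>A. \<forall>b\<in>A. \<forall>c\<in>A. m (m a b) c = m a (m b c))"

text \<open>The witness is the algebra of real polynomials in \<open>x\<close>. Commuting
  multiplications extend from powers to their span one factor at a time, and commuting
  multiplications together with commutativity give associativity:
  \<open>m c (m a b) = m a (m c b)\<close>.\<close>

lemma exists_assoc_subalgebra: "\<exists>A. assoc_subalgebra A \<and> x \<in> A"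
proof -
  define P where "P = range (jpow x)"
  have comm_P: "m p (m q y) = m q (m p y)" if "p \<in> P" "q \<in> P" for p q y
    using that jpow_commute by (auto simp: P_def)
  have comm_PA: "m p (m b y) = m b (m p y)" if "b \<in> span P" "p \<in> P" for p b y
    using that(1)
  proof (induction rule: span_induct)
    show "subspace {b. m p (m b y) = m b (m p y)}"
      by (simp add: subspace_def mult_distribs)
  qed (use that comm_P in auto)
  have comm_A: "m a (m b y) = m b (m a y)" if "a \<in> span P" "b \<in> span P" for a b y
    using that(1)
  proof (induction rule: span_induct)
    show "subspace {a. m a (m b y) = m b (m a y)}"
      by (simp add: subspace_def mult_distribs)
  qed (use that comm_PA in auto)
  have clos_PA: "m p b \<in> span P" if "p \<in> P" "b \<in> span P" for p b
    using that(2)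
  proof (induction rule: span_induct)
    show "subspace {b. m p b \<in> span P}"
      by (simp add: subspace_def mult_distribs span_add span_scale span_zero)
  qed (use that jpow_add in \<open>auto simp: P_def intro: span_base\<close>)
  have clos_A: "m a b \<in> span P" if "a \<in> span P" "b \<in> span P" for a b
    using that(1)
  proof (induction rule: span_induct)
    show "subspace {a. m a b \<in> span P}"
      by (simp add: subspace_def mult_distribs span_add span_scale span_zero)
  qed (use that clos_PA in auto)
  have "m (m a b) c = m a (m b c)" if "a \<in> span P" "b \<in> span P" "c \<in> span P" for a b c
    using comm_A[of c a b] that by (metis comm)
  moreover have "e \<in> span P" "x \<in> span P"
    using jpow_0[of x] jpow_Suc[of x 0] unfolding P_def
    by (metis rangeI span_base, metis rangeI span_base unit_right jpow_0)
  ultimately show ?thesis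
    using clos_A subspace_span unfolding assoc_subalgebra_def by blast
qed

section \<open>Squares act as positive semidefinite multiplications\<close>

text \<open>For \<open>c\<^sup>2 = c\<close>, multiplication \<open>L\<close> by \<open>c\<close> satisfies \<open>2 L\<^sup>3 = 3 L\<^sup>2 - L\<close>, hence
  \<open>L = L\<^sup>2 + 4 (L - L\<^sup>2)\<^sup>2\<close>.\<close>
lemma idempotent_nonneg:
  assumes "m c c = c"
  shows "inner (m c y) y \<ge> 0"
proof -
  define L where "L = m c"
  interpret L: linear L
    unfolding L_def by (rule linear_mult)
  have sym: "inner (L u) v = inner u (L v)" for u v
    by (simp add: L_def inner_mult_sym)
  have cubic: "2 *\<^sub>R L (L (L y)) = 3 *\<^sub>R L (L y) - L y" for y
  proof -
    have "L y = L (L y) + 2 *\<^sub>R L (L y) - L (L (L y)) - L (L (L y))"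
      using mult_power_step[of c c y] unfolding assms L_def .
    moreover have "3 *\<^sub>R L (L y) = (1 + 2) *\<^sub>R L (L y)"
      by simp
    ultimately show ?thesis
      unfolding scaleR_left_distrib scaleR_one scaleR_2 by (simp add: algebra_simps)
  qed
  define p where "p = inner (L y) y"
  define q where "q = inner (L (L y)) y"
  have c3: "2 * inner (L (L (L y))) y = 3 * q - p"
    using arg_cong[OF cubic[of y], of "\<lambda>v. inner v y"] by (simp add: inner_diff_left p_def q_def)
  have c4: "2 * inner (L (L (L (L y)))) y = 3 * inner (L (L (L y))) y - q"
    using arg_cong[OF cubic[of "L y"], of "\<lambda>v. inner v y"] by (simp add: inner_diff_left q_def)
  have "p = inner (L y) (L y) + 4 * inner (L y - L (L y)) (L y - L (L y))"
    using c3 c4 by (simp add: inner_diff_left inner_diff_right p_def q_def L.diff flip: sym)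
  then show ?thesis
    by (simp add: p_def L_def)
qed

text \<open>A minimizer of the quadratic form on the compact unit sphere of \<open>A\<close> is an
  eigenvector: otherwise its residual, which stays in \<open>A\<close> by invariance, would be a
  direction along which the Rayleigh quotient decreases.\<close>

lemma exists_min_eigenvalue:
  assumes A: "subspace A" "A \<noteq> {0}" and inv: "\<And>a. a \<in> A \<Longrightarrow> m q a \<in> A"
  obtains \<mu> v where "v \<in> A" "v \<noteq> 0" "m q v = \<mu> *\<^sub>R v"
    "\<And>a. a \<in> A \<Longrightarrow> inner (m q a) a \<ge> \<mu> * (norm a)\<^sup>2"
proof -
  define f where "f v = inner (m q v) v" for v
  have "compact (A \<inter> sphere 0 1)"
    using A by (simp add: closed_subspace closed_Int_compact)
  moreover obtain a where a: "a \<in> A" "a \<noteq> 0"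
    using A subspace_0 by blast
  then have "(1 / norm a) *\<^sub>R a \<in> A \<inter> sphere 0 1"
    using A by (simp add: subspace_scale)
  then have "A \<inter> sphere 0 1 \<noteq> {}"
    by blast
  moreover have "continuous_on (A \<inter> sphere 0 1) f"
    unfolding f_def by (intro continuous_on_inner continuous_on_mult continuous_intros)
  ultimately obtain v where v0: "v \<in> A \<inter> sphere 0 1" "\<forall>u\<in>A \<inter> sphere 0 1. f v \<le> f u"
    using continuous_attains_inf[of "A \<inter> sphere 0 1" f] by blast
  then have v: "v \<in> A" "norm v = 1"
    by auto
  have vmin: "f v \<le> f u" if "u \<in> A" "norm u = 1" for u
    using v0(2) that by auto
  have f_scale: "f (t *\<^sub>R u) = t\<^sup>2 * f u" for t u
    by (simp add: f_def mult_distribs power2_eq_square)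
  have min: "f u \<ge> f v * (norm u)\<^sup>2" if "u \<in> A" for u
  proof (cases "u = 0")
    case False
    have "f v \<le> f ((1 / norm u) *\<^sub>R u)"
      using False that A by (intro vmin) (auto simp: subspace_scale)
    also have "\<dots> = f u / (norm u)\<^sup>2"
      by (simp add: f_scale power_divide)
    finally show ?thesis
      using False by (simp add: field_simps)
  qed (simp add: f_def)
  define r where "r = m q v - f v *\<^sub>R v"
  have r: "r \<in> A"
    using v A inv by (simp add: r_def subspace_diff subspace_scale)
  have "r = 0"
  proof (rule ccontr)
    assume "r \<noteq> 0"
    define M where "M = f r - f v * (norm r)\<^sup>2"
    have pos: "0 \<le> 2 * t * (norm r)\<^sup>2 + t\<^sup>2 * M" for t
    proof -
      have "0 \<le> f (v + t *\<^sub>R r) - f v * (norm (v + t *\<^sub>R r))\<^sup>2"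
        using min[of "v + t *\<^sub>R r"] v r A by (simp add: subspace_add subspace_scale)
      also have "\<dots> = 2 * t * inner (m q v - f v *\<^sub>R v) r + t\<^sup>2 * M"
      proof -
        have "(norm (v + t *\<^sub>R r))\<^sup>2 = 1 + 2 * t * inner v r + t\<^sup>2 * (norm r)\<^sup>2"
          using v by (simp add: power2_norm_eq_inner inner_add_left inner_add_right
              inner_commute[of r v] norm_eq_1 power2_eq_square[of t] algebra_simps)
        moreover have "f (v + t *\<^sub>R r) = f v + 2 * t * inner (m q v) r + t\<^sup>2 * f r"
          by (simp add: f_def mult_distribs inner_add_left inner_add_right
              inner_mult_sym[of q r v] inner_commute[of r "m q v"] power2_eq_square algebra_simps)
        ultimately show ?thesis
          by (simp add: M_def inner_diff_left algebra_simps)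
      qed
      finally show ?thesis
        by (simp add: r_def dot_square_norm)
    qed
    define N where "N = (norm r)\<^sup>2"
    have "N > 0" "M \<ge> 0"
      using \<open>r \<noteq> 0\<close> min[OF r] by (auto simp: N_def M_def)
    \<comment> \<open>A step small enough for the linear term to dominate: \<open>s * M < N\<close>,
      whereas minimality along \<open>- s\<close> would force
      \<open>2 * N \<le> s * M\<close>.\<close>
    define s where "s = N / (M + 1)"
    have "s > 0" "s * (M + 1) = N"
      using \<open>N > 0\<close> \<open>M \<ge> 0\<close> by (simp_all add: s_def)
    have "0 \<le> s * (s * M - 2 * N)"
      using pos[of "- s"] by (simp add: N_def power2_eq_square algebra_simps)
    then have "2 * N \<le> s * M"
      using \<open>s > 0\<close> by (simp add: zero_le_mult_iff)
    then show False
      using \<open>s > 0\<close> \<open>s * (M + 1) = N\<close> \<open>N > 0\<close> by (simp add: distrib_left)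
  qed
  then show thesis
    using that[of v "f v"] v min norm_zero by (fastforce simp: r_def f_def)
qed

text \<open>The projection \<open>q\<close> of \<open>z\<^sup>2\<close> to \<open>\<real>[x]\<close> acts nonnegatively there:
  the eigenspace of its least eigenvalue \<open>\<mu>\<close> is an ideal of \<open>\<real>[x]\<close>, whose unit
  is an idempotent \<open>c\<close> with \<open>\<mu> \<bar>c\<bar>\<^sup>2 = \<langle>c, z\<^sup>2\<rangle> \<ge> 0\<close>.\<close>
lemma square_nonneg: "inner (m (m x x) z) z \<ge> 0"
proof -
  obtain A where A: "assoc_subalgebra A" "x \<in> A"
    using exists_assoc_subalgebra by blast
  have sub: "subspace A" and eA: "e \<in> A"
    and clos: "\<And>a b. a \<in> A \<Longrightarrow> b \<in> A \<Longrightarrow> m a b \<in> A"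
    and assoc: "\<And>a b c. a \<in> A \<Longrightarrow> b \<in> A \<Longrightarrow> c \<in> A \<Longrightarrow> m (m a b) c = m a (m b c)"
    using A unfolding assoc_subalgebra_def by blast+
  obtain q r where q: "q \<in> span A" and r: "\<And>w. w \<in> span A \<Longrightarrow> orthogonal r w" and "m z z = q + r"
    using orthogonal_subspace_decomp_exists[of A "m z z"] by blast
  have span: "span A = A"
    using sub by (simp add: span_eq_iff)
  have qA: "q \<in> A"
    using q span by simp
  have proj: "inner a q = inner (m a z) z" if "a \<in> A" for a
  proof -
    have "inner a r = 0"
      using r[of a] that span by (simp add: orthogonal_def inner_commute)
    then have "inner a q = inner a (m z z)"
      by (simp add: \<open>m z z = q + r\<close> inner_add_right)
    then show ?thesis
      by (simp add: assoc_inner)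
  qed
  obtain \<mu> v where v: "v \<in> A" "v \<noteq> 0" "m q v = \<mu> *\<^sub>R v"
    and min: "\<And>a. a \<in> A \<Longrightarrow> inner (m q a) a \<ge> \<mu> * (norm a)\<^sup>2"
    using exists_min_eigenvalue[of A q] sub eA unit_nonzero qA clos by (metis singletonD)
  define I where "I = {a \<in> A. m q a = \<mu> *\<^sub>R a}"
  have subI: "subspace I"
    using sub unfolding I_def subspace_def by (auto simp: mult_distribs algebra_simps)
  have ideal: "m a u \<in> I" if "a \<in> A" "u \<in> I" for a u
  proof -
    have "m q (m a u) = m a (m q u)"
      using assoc that qA by (metis (no_types, lifting) I_def comm mem_Collect_eq)
    then show ?thesis
      using that clos by (simp add: I_def mult_distribs)
  qed
  \<comment> \<open>The unit of the ideal is the orthogonal projection \<open>c\<close> of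
    \<open>e\<close>. The complement \<open>s\<close> annihilates \<open>I\<close>, because
    \<open>inner (m s u) (m s u) = inner s (m u (m s u))\<close> and the last product lies in
    \<open>I\<close>.\<close>
  obtain c s where c: "c \<in> I" and s: "\<And>u. u \<in> I \<Longrightarrow> inner s u = 0" and ec: "e = c + s"
    using orthogonal_subspace_decomp_exists[of I e] subI
    by (metis orthogonal_def span_eq_iff)
  have cA: "c \<in> A"
    using c by (simp add: I_def)
  have unit: "m c u = u" if u: "u \<in> I" for u
  proof -
    have "m s u \<in> I"
    proof -
      have "s \<in> A"
        using ec eA cA sub by (metis add_diff_cancel_left' subspace_diff)
      then show ?thesis
        using ideal u by blast
    qed
    moreover have uA: "u \<in> A"
      using u by (simp add: I_def)
    ultimately have "inner (m s u) (m s u) = 0"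
      using s ideal[OF uA \<open>m s u \<in> I\<close>] comm[of s u] by (simp add: inner_mult_sym[of u s] )
    then have "m s u = 0"
      by simp
    moreover have "m c u + m s u = u"
      using ec by (metis mult_distribs(1) unit_left)
    ultimately show ?thesis
      by simp
  qed
  have idem: "m c c = c"
    by (rule unit[OF c])
  have "c \<noteq> 0"
    using unit[of v] v by (auto simp: I_def)
  have "0 \<le> inner (m c z) z"
    by (rule idempotent_nonneg[OF idem])
  also have "\<dots> = inner (m c c) q"
    using proj[OF cA] idem by simp
  also have "\<dots> = \<mu> * (norm c)\<^sup>2"
    using c by (simp add: inner_mult_sym I_def comm[of c q] dot_square_norm)
  finally have "\<mu> \<ge> 0"
    using \<open>c \<noteq> 0\<close> by (simp add: zero_le_mult_iff)
  \<comment> \<open>The eigenvalue bound is evaluated at \<open>x\<close> itself. Its right-hand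
    side is \<open>inner (m x x) q\<close>, which the projection property turns into the desired
    form.\<close>
  have "0 \<le> \<mu> * (norm x)\<^sup>2"
    using \<open>\<mu> \<ge> 0\<close> by simp
  also have "\<dots> \<le> inner (m q x) x"
    by (rule min[OF A(2)])
  also have "\<dots> = inner (m x x) q"
    using inner_mult_sym[of x q x] by (simp add: comm[of q x] inner_commute)
  also have "\<dots> = inner (m (m x x) z) z"
    using A clos by (intro proj) auto
  finally show ?thesis .
qed

section \<open>The symmetric cone as the interior of a convex cone\<close>

definition psd :: "'a set" where
  "psd = {y. \<forall>z. inner (m y z) z \<ge> 0}"

lemma psd_add: "x \<in> psd \<Longrightarrow> y \<in> psd \<Longrightarrow> x + y \<in> psd"
  and psd_scale: "s \<ge> 0 \<Longrightarrow> x \<in> psd \<Longrightarrow> s *\<^sub>R x \<in> psd"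
  by (auto simp: psd_def mult_distribs inner_add_left)

lemma convex_psd: "convex psd"
  by (auto simp: convex_def intro!: psd_add psd_scale)

text \<open>Within distance \<open>1 / B\<close> of \<open>e\<close>, multiplication by
  \<open>e - y\<close> has norm at most 1, so subtracting it from the identity leaves a nonnegative
  form.\<close>

lemma unit_interior_psd: "e \<in> interior psd"
proof -
  obtain B where B: "B > 0" "\<And>x y. norm (m x y) \<le> B * norm x * norm y"
    using norm_mult_bound by blast
  have "ball e (1 / B) \<subseteq> psd"
  proof
    fix y assume "y \<in> ball e (1 / B)"
    then have y: "norm (e - y) * B \<le> 1"
      using B by (simp add: dist_norm field_simps)
    show "y \<in> psd"
      unfolding psd_def
    proof safe
      fix z
      have "inner (m (e - y) z) z \<le> norm (m (e - y) z) * norm z"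
        by (rule norm_cauchy_schwarz)
      also have "\<dots> \<le> (B * norm (e - y) * norm z) * norm z"
        by (intro mult_right_mono B) auto
      also have "\<dots> = (norm (e - y) * B) * (norm z)\<^sup>2"
        by (simp add: power2_eq_square)
      also have "\<dots> \<le> (norm z)\<^sup>2"
        using mult_right_mono[OF y, of "(norm z)\<^sup>2"] by simp
      finally show "0 \<le> inner (m y z) z"
        by (simp add: mult_distribs inner_diff_left dot_square_norm)
    qed
  qed
  then show ?thesis
    using B by (intro interiorI[of "ball e (1 / B)"]) auto
qed

text \<open>After scaling, \<open>y = e - k\<close> where multiplication by \<open>k\<close> is a strict contraction; then
  \<open>y = (e - h)\<^sup>2\<close> for the fixed point \<open>h\<close> of \<open>h \<mapsto> (k + h\<^sup>2) / 2\<close> in \<open>\<real>[y]\<close>.\<close>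
lemma interior_psd_square:
  assumes "y \<in> interior psd"
  shows "\<exists>s. y = m s s"
proof -
  obtain \<epsilon> where eps: "\<epsilon> > 0" "cball y \<epsilon> \<subseteq> psd"
    using assms mem_interior_cball by metis
  \<comment> \<open>Moving from \<open>y\<close> by \<open>\<delta> *\<^sub>R e\<close> has length
    \<epsilon> and so stays in \<open>psd\<close>; this makes the form of \<open>y\<close> bounded
    below by \<delta>.\<close>
  define \<delta> where "\<delta> = \<epsilon> / norm e"
  have "\<delta> > 0"
    using eps unit_nonzero by (simp add: \<delta>_def)
  have "y - \<delta> *\<^sub>R e \<in> psd"
    using eps unit_nonzero by (intro subsetD[OF eps(2)]) (simp add: \<delta>_def dist_norm)
  then have lower: "\<delta> * (norm z)\<^sup>2 \<le> inner (m y z) z" for z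
    by (simp add: psd_def mult_distribs inner_diff_left dot_square_norm)
  obtain B0 where B0: "B0 > 0" "\<And>x y. norm (m x y) \<le> B0 * norm x * norm y"
    using norm_mult_bound by blast
  define B where "B = B0 * norm y + 1"
  have "B > 0" and upper: "norm (m y z) \<le> B * norm z" for z
  proof -
    show "B > 0"
      using B0 by (simp add: B_def add_nonneg_pos)
    show "norm (m y z) \<le> B * norm z"
      using B0(2)[of y z] by (simp add: B_def algebra_simps add_increasing)
  qed
  \<comment> \<open>The minimizer of \<open>1 - 2 * t * \<delta> + t\<^sup>2 * B\<^sup>2\<close>,
    with minimum \<open>1 - \<delta>\<^sup>2 / B\<^sup>2\<close>; this is the square of the
    contraction factor \<open>q\<close> of \<open>k\<close>.\<close>
  define t where "t = \<delta> / B\<^sup>2"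
  define k where "k = e - t *\<^sub>R y"
  have "t > 0"
    using \<open>\<delta> > 0\<close> \<open>B > 0\<close> by (simp add: t_def)
  define q where "q = sqrt (1 - \<delta>\<^sup>2 / B\<^sup>2)"
  have k2: "(norm (m k z))\<^sup>2 \<le> (1 - \<delta>\<^sup>2 / B\<^sup>2) * (norm z)\<^sup>2" for z
  proof -
    have "(norm (m k z))\<^sup>2 = (norm z)\<^sup>2 - 2 * t * inner (m y z) z + t\<^sup>2 * (norm (m y z))\<^sup>2"
      unfolding k_def dot_square_norm[symmetric] mult_distribs unit_left
      by (simp add: inner_diff_left inner_diff_right inner_commute[of z "m y z"] power2_eq_square algebra_simps)
    also have "\<dots> \<le> (norm z)\<^sup>2 - 2 * t * (\<delta> * (norm z)\<^sup>2) + t\<^sup>2 * (B * norm z)\<^sup>2"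
      using lower[of z] upper[of z] \<open>t > 0\<close>
      by (intro add_mono diff_mono mult_left_mono power_mono) auto
    also have "\<dots> = (1 - \<delta>\<^sup>2 / B\<^sup>2) * (norm z)\<^sup>2"
      using \<open>B > 0\<close> by (simp add: t_def field_simps power2_eq_square)
    finally show ?thesis .
  qed
  have "q \<ge> 0" "q < 1"
  proof -
    have "0 \<le> (1 - \<delta>\<^sup>2 / B\<^sup>2) * (norm e)\<^sup>2"
      using k2[of e] by (rule order_trans[rotated]) simp
    then show "q \<ge> 0"
      using unit_nonzero by (simp add: q_def zero_le_mult_iff)
    show "q < 1"
      using \<open>\<delta> > 0\<close> \<open>B > 0\<close> by (simp add: q_def)
  qed
  have k1: "norm (m k z) \<le> q * norm z" for z
    using real_sqrt_le_mono[OF k2[of z]] by (simp add: q_def real_sqrt_mult)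
  \<comment> \<open>The smaller root of \<open>\<rho>\<^sup>2 - 2 * \<rho> + q = 0\<close>, so that
    the bound \<open>(q + \<rho>\<^sup>2) / 2\<close> for the image under \<open>f\<close> is again
    \<rho>.\<close>
  define \<rho> where "\<rho> = 1 - sqrt (1 - q)"
  have rho: "\<rho> \<ge> 0" "\<rho> < 1" "q + \<rho>\<^sup>2 = 2 * \<rho>"
    using \<open>q \<ge> 0\<close> \<open>q < 1\<close> by (auto simp: \<rho>_def power2_diff)
  obtain A where A: "assoc_subalgebra A" "y \<in> A"
    using exists_assoc_subalgebra by blast
  have sub: "subspace A" and eA: "e \<in> A"
    and clos: "\<And>a b. a \<in> A \<Longrightarrow> b \<in> A \<Longrightarrow> m a b \<in> A"
    and assoc: "\<And>a b c. a \<in> A \<Longrightarrow> b \<in> A \<Longrightarrow> c \<in> A \<Longrightarrow> m (m a b) c = m a (m b c)"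
    using A unfolding assoc_subalgebra_def by blast+
  have kA: "k \<in> A"
    using sub eA A by (simp add: k_def subspace_diff subspace_scale)
  \<comment> \<open>Elements of \<open>A\<close> whose multiplication on \<open>A\<close> has norm
    at most \<rho>. With this operator bound, associativity on \<open>A\<close> controls squares,
    and \<open>f\<close> contracts distances in \<open>E\<close> because differences
    \<open>h - g\<close> lie in \<open>A\<close>.\<close>
  define S where "S = A \<inter> (\<Inter>a\<in>A. {h. norm (m h a) \<le> \<rho> * norm a})"
  define f where "f h = (1/2) *\<^sub>R (k + m h h)" for h
  have bound: "norm (m h a) \<le> \<rho> * norm a" if "h \<in> S" "a \<in> A" for h a
    using that by (auto simp: S_def)
  have "closed S"
    unfolding S_def using sub
    by (intro closed_Int closed_subspace closed_INT ballI closed_Collect_le continuous_on_norm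
        continuous_on_mult continuous_intros)
  then have "complete S"
    by (simp add: complete_eq_closed)
  moreover have "S \<noteq> {}"
  proof -
    have "0 \<in> S"
      using sub rho by (simp add: S_def subspace_0)
    then show ?thesis by blast
  qed
  moreover have "f ` S \<subseteq> S"
  proof safe
    fix h assume h: "h \<in> S"
    then have hA: "h \<in> A"
      by (simp add: S_def)
    have "norm (m (f h) a) \<le> \<rho> * norm a" if a: "a \<in> A" for a
    proof -
      have "norm (m (m h h) a) \<le> \<rho> * (\<rho> * norm a)"
        unfolding assoc[OF hA hA a]
        using bound[OF h clos[OF hA a]] bound[OF h a] rho(1) by (meson mult_left_mono order_trans)
      then have "norm (m k a + m (m h h) a) \<le> (q + \<rho>\<^sup>2) * norm a"
        using k1[of a] norm_triangle_ineq[of "m k a" "m (m h h) a"]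
        by (simp add: power2_eq_square algebra_simps)
      then show ?thesis
        by (simp add: f_def mult_distribs rho(3))
    qed
    moreover have "f h \<in> A"
      using kA hA clos sub by (simp add: f_def subspace_add subspace_scale)
    ultimately show "f h \<in> S"
      by (simp add: S_def)
  qed
  moreover have "dist (f h) (f g) \<le> \<rho> * dist h g" if h: "h \<in> S" and g: "g \<in> S" for h g
  proof -
    have hg: "h - g \<in> A"
      using h g sub by (simp add: S_def subspace_diff)
    have "f h - f g = (1/2) *\<^sub>R (m h (h - g) + m g (h - g))"
      by (simp add: f_def mult_distribs comm[of g h] flip: scaleR_diff_right)
    then have "norm (f h - f g) \<le> (1/2) * (norm (m h (h - g)) + norm (m g (h - g)))"
      using norm_triangle_ineq[of "m h (h - g)" "m g (h - g)"] by simp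
    also have "\<dots> \<le> \<rho> * norm (h - g)"
      using bound[OF h hg] bound[OF g hg] by simp
    finally show ?thesis
      by (simp add: dist_norm)
  qed
  ultimately obtain h where "h \<in> S" "f h = h"
    using Banach_fix[of S \<rho> f] rho by metis
  moreover have "2 *\<^sub>R f h = k + m h h"
    by (simp add: f_def)
  ultimately have "2 *\<^sub>R h = k + m h h"
    by simp
  \<comment> \<open>The fixed-point equation completes the square:
    \<open>e - 2 *\<^sub>R h + m h h = e - k\<close>.\<close>
  then have "m (e - h) (e - h) = t *\<^sub>R y"
    by (simp add: mult_distribs k_def scaleR_2 algebra_simps)
  then have "y = m ((1 / sqrt t) *\<^sub>R (e - h)) ((1 / sqrt t) *\<^sub>R (e - h))"
    using \<open>t > 0\<close> by (simp add: mult_distribs(5,6))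
  then show ?thesis
    by blast
qed

text \<open>The set of squares lies between \<open>interior psd\<close> and \<open>psd\<close>, so
  it has the same interior. Convexity, not evident for squares, is immediate for
  \<open>psd\<close>.\<close>

lemma sym_cone_eq_interior_psd: "sym_cone m = interior psd"
proof (rule antisym)
  have "{m x x |x. True} \<subseteq> psd"
    using square_nonneg by (auto simp: psd_def)
  then show "sym_cone m \<subseteq> interior psd"
    unfolding sym_cone_def by (rule interior_mono)
  have "interior psd \<subseteq> {m x x |x. True}"
    using interior_psd_square by blast
  then show "interior psd \<subseteq> sym_cone m"
    unfolding sym_cone_def by (rule interior_maximal) simp
qed

lemma open_sym_cone: "open (sym_cone m)"
  by (simp add: sym_cone_def)

lemma unit_in_sym_cone: "e \<in> sym_cone m"
  by (simp add: sym_cone_eq_interior_psd unit_interior_psd)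

lemma sym_cone_scale:
  assumes "s > 0" "x \<in> sym_cone m"
  shows "s *\<^sub>R x \<in> sym_cone m"
proof -
  have "(*\<^sub>R) s ` interior psd \<subseteq> interior psd"
  proof (rule interior_maximal)
    show "(*\<^sub>R) s ` interior psd \<subseteq> psd"
      using assms interior_subset psd_scale[of s] by (auto dest!: subsetD[OF interior_subset])
    show "open ((*\<^sub>R) s ` interior psd)"
      using assms by (intro open_scaling) auto
  qed
  then show ?thesis
    using assms by (auto simp: sym_cone_eq_interior_psd)
qed

lemma sym_cone_add:
  assumes "x \<in> sym_cone m" "y \<in> sym_cone m"
  shows "x + y \<in> sym_cone m"
proof -
  have "(1/2) *\<^sub>R x + (1/2) *\<^sub>R y \<in> sym_cone m"
    using assms convex_interior[OF convex_psd] unfolding sym_cone_eq_interior_psd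
    by (intro convexD) auto
  then have "2 *\<^sub>R ((1/2) *\<^sub>R x + (1/2) *\<^sub>R y) \<in> sym_cone m"
    by (intro sym_cone_scale) auto
  then show ?thesis
    by (simp add: scaleR_add_right)
qed

end

subsection \<open>The additive Pexider equation on an open convex cone\<close>

lemma additive_pos_imp_linear:
  fixes k :: "real \<Rightarrow> real"
  assumes add: "\<And>s t. s > 0 \<Longrightarrow> t > 0 \<Longrightarrow> k (s + t) = k s + k t"
    and cont: "continuous_on {0<..} k" and "t > 0"
  shows "k t = t * k 1"
proof -
  have mult: "k (real (Suc n) * s) = real (Suc n) * k s" if "s > 0" for n s
  proof (induction n)
    case (Suc n)
    have "real (Suc (Suc n)) * s = real (Suc n) * s + s"
      by (simp add: algebra_simps)
    also have "k \<dots> = k (real (Suc n) * s) + k s"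
      using that by (intro add) simp_all
    finally show ?case
      unfolding Suc by (simp add: algebra_simps)
  qed simp
  \<comment> \<open>Rational approximations from above, hence positive, so additivity determines
    \<open>k\<close> on them; continuity then carries the formula to \<open>t\<close>.\<close>
  define r where "r n = real (nat \<lceil>real (Suc n) * t\<rceil>) / real (Suc n)" for n
  have r_eq: "real (nat \<lceil>real (Suc n) * t\<rceil>) = real_of_int \<lceil>real (Suc n) * t\<rceil>" for n
    using \<open>t > 0\<close> by (simp add: of_nat_nat zero_le_ceiling order.strict_trans2[of _ 0])
  have r_bounds: "t \<le> r n" "r n \<le> t + 1 / real (Suc n)" for n
  proof -
    have "real (Suc n) * t \<le> real_of_int \<lceil>real (Suc n) * t\<rceil>"
      by (rule le_of_int_ceiling)
    then show "t \<le> r n"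
      unfolding r_def r_eq by (simp add: le_divide_eq mult.commute)
    have "real_of_int \<lceil>real (Suc n) * t\<rceil> \<le> real (Suc n) * t + 1"
      by (rule of_int_ceiling_le_add_one)
    then show "r n \<le> t + 1 / real (Suc n)"
      unfolding r_def r_eq by (simp add: divide_simps mult.commute)
  qed
  have kr: "k (r n) = r n * k 1" for n
  proof -
    have "r n > 0"
      using r_bounds(1)[of n] \<open>t > 0\<close> by simp
    define N where "N = nat \<lceil>real (Suc n) * t\<rceil>"
    have N: "real (Suc n) * r n = real N"
      by (simp add: r_def N_def)
    have "real N > 0"
      using \<open>r n > 0\<close> N mult_pos_pos[of "real (Suc n)" "r n"] by simp
    then obtain j where "N = Suc j"
      using gr0_implies_Suc by auto
    then have "real (Suc n) * k (r n) = real N * k 1"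
      using mult[OF \<open>r n > 0\<close>, of n] mult[of 1 j] N by simp
    then have "real (Suc n) * k (r n) = real (Suc n) * (r n * k 1)"
      by (simp only: N[symmetric] mult.assoc)
    then show ?thesis
      by (simp only: mult_cancel_left of_nat_0_eq_iff) simp
  qed
  have r_lim: "r \<longlonglongrightarrow> t"
  proof (rule tendsto_sandwich[of "\<lambda>_. t" r _ "\<lambda>n. t + 1 / real (Suc n)"])
    show "(\<lambda>n. t + 1 / real (Suc n)) \<longlonglongrightarrow> t"
      using tendsto_add[OF tendsto_const[of t] LIMSEQ_inverse_real_of_nat]
      by (simp add: inverse_eq_divide)
  qed (simp_all only: r_bounds eventually_True tendsto_const)
  have "isCont k t"
    using cont \<open>t > 0\<close> by (simp add: continuous_on_eq_continuous_at)
  then have "(\<lambda>n. k (r n)) \<longlonglongrightarrow> k t"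
    by (rule isCont_tendsto_compose) (rule r_lim)
  moreover have "(\<lambda>n. k (r n)) \<longlonglongrightarrow> t * k 1"
    unfolding kr by (intro tendsto_mult r_lim tendsto_const)
  ultimately show ?thesis
    by (rule LIMSEQ_unique)
qed

locale open_convex_cone =
  fixes S :: "'a::euclidean_space set" and p :: 'a
  assumes open_S: "open S" and p: "p \<in> S"
    and add_S: "\<And>x y. x \<in> S \<Longrightarrow> y \<in> S \<Longrightarrow> x + y \<in> S"
    and scale_S: "\<And>s x. s > 0 \<Longrightarrow> x \<in> S \<Longrightarrow> s *\<^sub>R x \<in> S"
begin

lemma small_perturbation:
  assumes "x \<in> S"
  shows "eventually (\<lambda>s. x + s *\<^sub>R v \<in> S) (at_right 0)"
proof -
  have "((\<lambda>s. x + s *\<^sub>R v) \<longlongrightarrow> x) (at_right 0)"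
    by (auto intro!: tendsto_eq_intros)
  then show ?thesis
    using open_S assms by (rule topological_tendstoD)
qed

text \<open>This writes every vector as a difference of two points of the cone. Openness gives
  \<open>p + s *\<^sub>R v \<in> S\<close> for small \<open>s\<close>, and dividing by
  \<open>s\<close> moves the coefficient to \<open>p\<close>.\<close>

lemma absorbing: "\<exists>s>0. v + s *\<^sub>R p \<in> S"
proof -
  have "eventually (\<lambda>s. p + s *\<^sub>R v \<in> S \<and> 0 < s) (at_right 0)"
    by (intro eventually_conj small_perturbation p eventually_at_right_less)
  then obtain s where s: "s > 0" "p + s *\<^sub>R v \<in> S"
    using eventually_happens' trivial_limit_at_right_real by blast
  then have "(1 / s) *\<^sub>R (p + s *\<^sub>R v) \<in> S"
    by (intro scale_S) auto
  then show ?thesis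
    using s by (intro exI[of _ "1 / s"]) (simp add: scaleR_add_right add.commute)
qed

lemma additive_imp_inner:
  assumes add: "\<And>x y. x \<in> S \<Longrightarrow> y \<in> S \<Longrightarrow> \<phi> (x + y) = \<phi> x + \<phi> y"
    and cont: "continuous_on S \<phi>"
  shows "\<exists>l. \<forall>x\<in>S. \<phi> x = inner l x"
proof -
  have scale: "\<phi> (t *\<^sub>R x) = t * \<phi> x" if "x \<in> S" "t > 0" for t x
  proof -
    have "continuous_on {0<..} (\<lambda>t. \<phi> (t *\<^sub>R x))"
      using that by (intro continuous_on_compose2[OF cont] continuous_intros) (auto simp: scale_S)
    then show ?thesis
      using additive_pos_imp_linear[of "\<lambda>t. \<phi> (t *\<^sub>R x)" t] that
      by (simp add: scaleR_add_left add scale_S)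
  qed
  obtain \<tau> where tau: "\<And>v. \<tau> v > 0" "\<And>v. v + \<tau> v *\<^sub>R p \<in> S"
    using absorbing by metis
  \<comment> \<open>The extension of \<phi> to the whole space through differences of cone points.
    Additivity makes it independent of the chosen base point, as \<open>Phi\<close> records, and
    hence linear.\<close>
  define \<Phi> where "\<Phi> v = \<phi> (v + \<tau> v *\<^sub>R p) - \<phi> (\<tau> v *\<^sub>R p)" for v
  have Phi: "\<Phi> v = \<phi> (v + q) - \<phi> q" if "q \<in> S" "v + q \<in> S" for v q
    using add[of "v + \<tau> v *\<^sub>R p" q] add[of "v + q" "\<tau> v *\<^sub>R p"] tau[of v] that
    by (simp add: \<Phi>_def scale_S p add_ac)
  have Phi_S: "\<Phi> x = \<phi> x" if "x \<in> S" for x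
    using Phi[of p x] that p by (simp add: add add_S)
  have Phi_add: "\<Phi> (u + v) = \<Phi> u + \<Phi> v" for u v
  proof -
    define P where "P = \<tau> u *\<^sub>R p"
    define Q where "Q = \<tau> v *\<^sub>R p"
    have S: "P \<in> S" "Q \<in> S" "u + P \<in> S" "v + Q \<in> S"
      using tau by (simp_all add: P_def Q_def scale_S p)
    have eq: "(u + P) + (v + Q) = (u + v) + (P + Q)"
      by simp
    then have "\<Phi> (u + v) = \<phi> ((u + P) + (v + Q)) - \<phi> (P + Q)"
      using S add_S by (metis Phi)
    then show ?thesis
      using S by (simp add: add Phi[of P u] Phi[of Q v])
  qed
  have Phi_scale_pos: "\<Phi> (t *\<^sub>R v) = t * \<Phi> v" if "t > 0" for t v
  proof -
    define P where "P = \<tau> v *\<^sub>R p"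
    have S: "P \<in> S" "v + P \<in> S"
      using tau by (simp_all add: P_def scale_S p)
    have "\<Phi> (t *\<^sub>R v) = \<phi> (t *\<^sub>R (v + P)) - \<phi> (t *\<^sub>R P)"
      using Phi[of "t *\<^sub>R P" "t *\<^sub>R v"] S that scale_S[of t P] scale_S[of t "v + P"]
      by (simp add: scaleR_add_right)
    then show ?thesis
      using S that by (simp add: scale Phi[of P v] right_diff_distrib)
  qed
  have Phi_0: "\<Phi> 0 = 0"
    using Phi_add[of 0 0] by simp
  have Phi_minus: "\<Phi> (- v) = - \<Phi> v" for v
    using Phi_add[of v "- v"] Phi_0 by simp
  have "linear \<Phi>"
  proof (rule linearI)
    fix t :: real and v
    consider "t > 0" | "t = 0" | "- t > 0"
      by linarith
    then show "\<Phi> (t *\<^sub>R v) = t *\<^sub>R \<Phi> v"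
    proof cases
      case 3
      then show ?thesis
        using Phi_scale_pos[of "- t" v] Phi_minus[of "t *\<^sub>R v"] by simp
    qed (simp_all add: Phi_scale_pos Phi_0)
  qed (rule Phi_add)
  then have "\<Phi> x = inner (adjoint \<Phi> 1) x" for x
    using adjoint_works[of \<Phi> x 1] by (simp add: inner_commute)
  then show ?thesis
    using Phi_S by metis
qed

lemma pexider:
  assumes feq: "\<And>x y. x \<in> S \<Longrightarrow> y \<in> S \<Longrightarrow> f x + g y = h (x + y)"
    and cont: "continuous_on S f"
  shows "\<exists>l A B. \<forall>x\<in>S. f x = inner l x + A \<and> g x = inner l x + B \<and> h x = inner l x + A + B"
proof -
  define \<kappa> where "\<kappa> = g p - f p"
  have g: "g x = f x + \<kappa>" if "x \<in> S" for x
    using feq[OF that p] feq[OF p that] by (simp add: \<kappa>_def add.commute)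
  have h: "h (x + y) = f x + f y + \<kappa>" if "x \<in> S" "y \<in> S" for x y
    using feq[of x y] g[of y] that by simp
  \<comment> \<open>The increment of \<open>f\<close> does not depend on the base point: evaluate
    \<open>h\<close> at \<open>x + y + p\<close> through the splittings \<open>(x + y, p)\<close>
    and \<open>(x, p + y)\<close>.\<close>
  define \<phi> where "\<phi> y = f (p + y) - f p" for y
  have phi: "f (x + y) = f x + \<phi> y" if "x \<in> S" "y \<in> S" for x y
    using h[of "x + y" p] h[of x "p + y"] that p by (simp add: \<phi>_def add_S add_ac)
  have "\<phi> (x + y) = \<phi> x + \<phi> y" if "x \<in> S" "y \<in> S" for x y
    using phi[of p "x + y"] phi[of "p + x" y] phi[of p x] that p by (simp add: add_S add.assoc)
  moreover have "continuous_on S \<phi>"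
    unfolding \<phi>_def by (intro continuous_intros continuous_on_compose2[OF cont]) (auto simp: add_S p)
  ultimately obtain l where l: "\<phi> x = inner l x" if "x \<in> S" for x
    using additive_imp_inner by blast
  define A where "A = f p - \<phi> p"
  have f: "f x = inner l x + A" if "x \<in> S" for x
    using phi[OF that p] phi[OF p that] l[OF that] by (simp add: A_def add.commute)
  \<comment> \<open>The equation gives \<open>h\<close> only at sums, so \<open>x\<close> is split
    into two equal halves.\<close>
  have half: "h x = inner l x + A + (A + \<kappa>)" if "x \<in> S" for x
  proof -
    have S: "(1/2) *\<^sub>R x \<in> S"
      using that by (intro scale_S) auto
    have "h ((1/2) *\<^sub>R x + (1/2) *\<^sub>R x) = f ((1/2) *\<^sub>R x) + f ((1/2) *\<^sub>R x) + \<kappa>"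
      by (rule h[OF S S])
    also have "(1/2) *\<^sub>R x + (1/2) *\<^sub>R x = x"
      by (simp flip: scaleR_add_left)
    finally show ?thesis
      by (simp add: f[OF S])
  qed
  show ?thesis
    using f g half by (intro exI[of _ l] exI[of _ A] exI[of _ "A + \<kappa>"]) simp
qed

text \<open>The difference \<open>n\<close> has constant inner product with points of
  \<open>S\<close>; comparing \<open>s *\<^sub>R p\<close> with \<open>n + s *\<^sub>R p\<close>
  leaves \<open>inner n n = 0\<close>.\<close>

lemma inner_affine_eq_imp_eq:
  assumes "\<And>x. x \<in> S \<Longrightarrow> inner l x + A = inner l' x + A'"
  shows "l = l'"
proof -
  define n where "n = l - l'"
  have n: "inner n x = A' - A" if "x \<in> S" for x
    using assms[OF that] by (simp add: n_def inner_diff_left)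
  obtain s where s: "s > 0" "n + s *\<^sub>R p \<in> S"
    using absorbing by blast
  have "inner n (n + s *\<^sub>R p) = inner n (s *\<^sub>R p)"
    using n[OF s(2)] n[OF scale_S[OF s(1) p]] by (simp only:)
  then show ?thesis
    by (simp add: inner_add_right n_def)
qed

text \<open>The increments \<open>x \<mapsto> f (s x) - f x\<close> satisfy the additive Pexider equation; comparing
  the two ways of writing \<open>f (2 s x) - f x\<close> shows that their slopes are \<open>(s - 1) \<Lambda>\<close>.\<close>
lemma increment_pexider:
  assumes feq: "\<And>s x y. s > 0 \<Longrightarrow> x \<in> S \<Longrightarrow> y \<in> S \<Longrightarrow>
      f (s *\<^sub>R x) + g (s *\<^sub>R y) - h (s *\<^sub>R (x + y)) = f x + g y - h (x + y)"
    and cont: "continuous_on S f"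
  shows "\<exists>\<Lambda> A B. \<forall>s>0. \<forall>x\<in>S.
      f (s *\<^sub>R x) = f x + (s - 1) * inner \<Lambda> x + A s \<and>
      g (s *\<^sub>R x) = g x + (s - 1) * inner \<Lambda> x + B s \<and>
      h (s *\<^sub>R x) = h x + (s - 1) * inner \<Lambda> x + A s + B s"
proof -
  have "\<exists>l A B. \<forall>x\<in>S. f (s *\<^sub>R x) - f x = inner l x + A \<and> g (s *\<^sub>R x) - g x = inner l x + B \<and>
      h (s *\<^sub>R x) - h x = inner l x + A + B" if "s > 0" for s
  proof (rule pexider)
    show "f (s *\<^sub>R x) - f x + (g (s *\<^sub>R y) - g y) = h (s *\<^sub>R (x + y)) - h (x + y)"
      if "x \<in> S" "y \<in> S" for x y
      using feq[OF \<open>s > 0\<close> that] by simp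
    show "continuous_on S (\<lambda>x. f (s *\<^sub>R x) - f x)"
      using \<open>s > 0\<close>
      by (intro continuous_intros cont continuous_on_compose2[OF cont]) (auto simp: scale_S)
  qed
  then obtain l A B where lAB: "\<forall>s>0. \<forall>x\<in>S. f (s *\<^sub>R x) - f x = inner (l s) x + A s \<and>
      g (s *\<^sub>R x) - g x = inner (l s) x + B s \<and> h (s *\<^sub>R x) - h x = inner (l s) x + A s + B s"
    by metis
  have l_eq: "l s = (s - 1) *\<^sub>R l 2" if "s > 0" for s
  proof -
    have "2 *\<^sub>R l s + l 2 = s *\<^sub>R l 2 + l s"
    proof (rule inner_affine_eq_imp_eq)
      fix x assume x: "x \<in> S"
      have "f (s *\<^sub>R (2 *\<^sub>R x)) = f x + inner (l 2) x + A 2 + inner (l s) (2 *\<^sub>R x) + A s"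
        using lAB[rule_format, OF \<open>s > 0\<close>, of "2 *\<^sub>R x"] lAB[rule_format, of 2 x] x scale_S[of 2 x]
        by simp
      moreover have "f (2 *\<^sub>R (s *\<^sub>R x)) = f x + inner (l s) x + A s + inner (l 2) (s *\<^sub>R x) + A 2"
        using lAB[rule_format, of 2 "s *\<^sub>R x"] lAB[rule_format, OF \<open>s > 0\<close> x] \<open>s > 0\<close> x scale_S[of s x]
        by simp
      ultimately show "inner (2 *\<^sub>R l s + l 2) x + (A s + A 2) = inner (s *\<^sub>R l 2 + l s) x + (A s + A 2)"
        by (simp add: inner_add_left mult.commute)
    qed
    then show ?thesis
      by (simp add: scaleR_2 scaleR_diff_left algebra_simps)
  qed
  have slope: "inner (l s) x = (s - 1) * inner (l 2) x" if "s > 0" for s x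
    unfolding l_eq[OF that] by simp
  show ?thesis
  proof (intro exI allI impI ballI)
    fix s :: real and x assume "s > 0" "x \<in> S"
    then show "f (s *\<^sub>R x) = f x + (s - 1) * inner (l 2) x + A s \<and>
      g (s *\<^sub>R x) = g x + (s - 1) * inner (l 2) x + B s \<and>
      h (s *\<^sub>R x) = h x + (s - 1) * inner (l 2) x + A s + B s"
      using lAB[rule_format, of s x] slope[of s x] by linarith
  qed
qed

end

subsection \<open>The functional equation\<close>

theorem theorem3p6:
  fixes m :: "'a::euclidean_space \<Rightarrow> 'a \<Rightarrow> 'a" and e :: 'a
    and w :: "'a \<Rightarrow> 'a \<Rightarrow> 'a" and a b c d :: "'a \<Rightarrow> real"
  assumes simple: "simple_eja m e"
    and walg: "multiplication_algorithm m e w"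
    and homog: "\<forall>s>0. \<forall>x\<in>sym_cone m. w (s *\<^sub>R x) = (\<lambda>v. s *\<^sub>R w x v)"
    and cont: "continuous_on (sym_cone m) a" "continuous_on (sym_cone m) b"
              "continuous_on (sym_cone m) c" "continuous_on (sym_cone m) d"
    and feq: "\<forall>x\<in>sym_cone m. \<forall>y\<in>sym_cone m.
               a x + b y = c (x + y) + d (inv (w (x + y)) x)"
  shows "\<exists>C1 C2 C3 C4 (\<Lambda>::'a) e0 f0.
           C1 + C2 = C3 + C4 \<and>
           continuous_on (sym_cone m) e0 \<and> w_log_cauchy m e w e0 \<and>
           continuous_on (sym_cone m) f0 \<and> w_log_cauchy m e w f0 \<and>
           (\<forall>x\<in>sym_cone m.
              a x = inner \<Lambda> x + e0 x + C1 \<and>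
              b x = inner \<Lambda> x + f0 x + C2 \<and>
              c x = inner \<Lambda> x + e0 x + f0 x + C3) \<and>
           (\<forall>u\<in>{z\<in>sym_cone m. e - z \<in> sym_cone m}.
              d u = e0 (w e u) + f0 (e - w e u) + C4)"
proof -
  define \<Omega> where "\<Omega> = sym_cone m"
  interpret eja m e
    using simple by unfold_locales (simp add: simple_eja_def)
  interpret open_convex_cone \<Omega> e
    unfolding \<Omega>_def
    by unfold_locales (auto intro: open_sym_cone unit_in_sym_cone sym_cone_add sym_cone_scale)
  have w: "linear (w x)" "bij (w x)" "w x ` \<Omega> = \<Omega>" "w x e = x" if "x \<in> \<Omega>" for x
  proof -
    have "w x \<in> cone_aut m"
      using walg that connected_component_subset[of "cone_aut m" id]
      by (auto simp: multiplication_algorithm_def cone_group_def \<Omega>_def)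
    then show "linear (w x)" "bij (w x)" "w x ` \<Omega> = \<Omega>"
      by (auto simp: cone_aut_def \<Omega>_def)
    show "w x e = x"
      using walg that by (simp add: multiplication_algorithm_def \<Omega>_def)
  qed
  have w_mem: "w x v \<in> \<Omega>" if "x \<in> \<Omega>" "v \<in> \<Omega>" for x v
    using w(3) that by blast
  have feq: "a x + b y = c (x + y) + d (inv (w (x + y)) x)" if "x \<in> \<Omega>" "y \<in> \<Omega>" for x y
    using feq that by (simp add: \<Omega>_def)
  have cont: "continuous_on \<Omega> a" "continuous_on \<Omega> b" "continuous_on \<Omega> c"
    using cont by (simp_all add: \<Omega>_def)
  have inv_scale: "inv (w (s *\<^sub>R z)) (s *\<^sub>R x) = inv (w z) x" if "s > 0" "z \<in> \<Omega>" for s x z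
  proof -
    have "w (s *\<^sub>R z) (inv (w z) x) = s *\<^sub>R x"
      using homog that w(2)[of z] by (simp add: \<Omega>_def bij_is_surj surj_f_inv_f)
    then show ?thesis
      using w(2) scale_S that by (metis bij_is_inj inv_f_f)
  qed
  have "a (s *\<^sub>R x) + b (s *\<^sub>R y) - c (s *\<^sub>R (x + y)) = a x + b y - c (x + y)"
    if "s > 0" "x \<in> \<Omega>" "y \<in> \<Omega>" for s x y
    using feq[of "s *\<^sub>R x" "s *\<^sub>R y"] feq[of x y] inv_scale[of s "x + y" x] that
    by (simp add: scale_S add_S flip: scaleR_add_right)
  then obtain \<Lambda> A B where incr: "\<forall>s>0. \<forall>x\<in>\<Omega>.
      a (s *\<^sub>R x) = a x + (s - 1) * inner \<Lambda> x + A s \<and>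
      b (s *\<^sub>R x) = b x + (s - 1) * inner \<Lambda> x + B s \<and>
      c (s *\<^sub>R x) = c x + (s - 1) * inner \<Lambda> x + A s + B s"
    using increment_pexider[of a b c] cont by blast
  define a0 where "a0 x = a x - inner \<Lambda> x" for x
  define b0 where "b0 x = b x - inner \<Lambda> x" for x
  define c0 where "c0 x = c x - inner \<Lambda> x" for x
  have scale0: "a0 (s *\<^sub>R x) = a0 x + A s" "b0 (s *\<^sub>R x) = b0 x + B s" if "s > 0" "x \<in> \<Omega>" for s x
    using incr that by (simp_all add: a0_def b0_def algebra_simps)
  have cont0: "continuous_on \<Omega> a0" "continuous_on \<Omega> b0"
    unfolding a0_def b0_def using cont by (auto intro!: continuous_intros)
  \<comment> \<open>The arguments \<open>w z u\<close> and \<open>z - w z u = w z (e - u)\<close>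
    lie in the cone and sum to \<open>z\<close>, so the linear terms in \<Lambda> cancel and
    \<open>d u\<close> is the same for every \<open>z\<close>.\<close>
  have d_eq: "d u = a0 (w z u) + b0 (z - w z u) - c0 z"
    if "z \<in> \<Omega>" "u \<in> \<Omega>" "e - u \<in> \<Omega>" for z u
  proof -
    have "z - w z u = w z (e - u)"
      using w(1,4)[OF that(1)] by (simp add: linear_diff)
    then have "z - w z u \<in> \<Omega>"
      using w_mem that by simp
    moreover have "inv (w z) (w z u) = u"
      using w(2)[OF that(1)] by (simp add: bij_is_inj)
    ultimately show ?thesis
      using feq[of "w z u" "z - w z u"] w_mem that
      by (simp add: a0_def b0_def c0_def inner_diff_right)
  qed
  have small: "eventually (\<lambda>s. s > 0 \<and> e - s *\<^sub>R v \<in> \<Omega>) (at_right 0)" for v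
    using eventually_conj[OF eventually_at_right_less[of 0] small_perturbation[OF p, of "- v"]]
    by simp
  have lim: "((\<lambda>s. f (z - s *\<^sub>R v)) \<longlongrightarrow> f z) (at_right 0)"
    if "continuous_on \<Omega> f" "z \<in> \<Omega>" for f :: "'a \<Rightarrow> real" and z v
  proof -
    have "isCont f z"
      using that open_S by (simp add: continuous_on_eq_continuous_at)
    moreover have "((\<lambda>s. z - s *\<^sub>R v) \<longlongrightarrow> z) (at_right 0)"
      by (auto intro!: tendsto_eq_intros)
    ultimately show ?thesis
      by (rule isCont_tendsto_compose)
  qed
  have a_lim: "a0 (w z v) + b0 z - c0 z = a0 (w e v) + b0 e - c0 e" if z: "z \<in> \<Omega>" and v: "v \<in> \<Omega>" for z v
  proof (rule tendsto_unique)
    show "((\<lambda>s. a0 (w z v) + b0 (z - s *\<^sub>R w z v) - c0 z) \<longlongrightarrow> a0 (w z v) + b0 z - c0 z) (at_right 0)"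
      by (intro tendsto_intros lim cont0 z)
    have "((\<lambda>s. a0 (w e v) + b0 (e - s *\<^sub>R w e v) - c0 e) \<longlongrightarrow> a0 (w e v) + b0 e - c0 e) (at_right 0)"
      by (intro tendsto_intros lim cont0 p)
    moreover have "eventually (\<lambda>s. a0 (w e v) + b0 (e - s *\<^sub>R w e v) - c0 e
        = a0 (w z v) + b0 (z - s *\<^sub>R w z v) - c0 z) (at_right 0)"
      using small[of v]
    proof eventually_elim
      case (elim s)
      then show ?case
        using d_eq[OF z, of "s *\<^sub>R v"] d_eq[OF p, of "s *\<^sub>R v"] w(1)[OF z] w(1)[OF p] w_mem z v p
        by (simp add: scale_S linear_cmul scale0)
    qed
    ultimately show "((\<lambda>s. a0 (w z v) + b0 (z - s *\<^sub>R w z v) - c0 z) \<longlongrightarrow>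
        a0 (w e v) + b0 e - c0 e) (at_right 0)"
      by (rule Lim_transform_eventually)
  qed simp
  \<comment> \<open>The mirror case takes \<open>u = e - s *\<^sub>R v\<close>: then
    \<open>w z u = z - s *\<^sub>R w z v\<close>, and the small argument is now that of
    \<open>b0\<close>.\<close>
  have b_lim: "b0 (w z v) + a0 z - c0 z = b0 (w e v) + a0 e - c0 e" if z: "z \<in> \<Omega>" and v: "v \<in> \<Omega>" for z v
  proof (rule tendsto_unique)
    show "((\<lambda>s. b0 (w z v) + a0 (z - s *\<^sub>R w z v) - c0 z) \<longlongrightarrow> b0 (w z v) + a0 z - c0 z) (at_right 0)"
      by (intro tendsto_intros lim cont0 z)
    have "((\<lambda>s. b0 (w e v) + a0 (e - s *\<^sub>R w e v) - c0 e) \<longlongrightarrow> b0 (w e v) + a0 e - c0 e) (at_right 0)"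
      by (intro tendsto_intros lim cont0 p)
    moreover have "eventually (\<lambda>s. b0 (w e v) + a0 (e - s *\<^sub>R w e v) - c0 e
        = b0 (w z v) + a0 (z - s *\<^sub>R w z v) - c0 z) (at_right 0)"
      using small[of v]
    proof eventually_elim
      case (elim s)
      then show ?case
        using d_eq[OF z, of "e - s *\<^sub>R v"] d_eq[OF p, of "e - s *\<^sub>R v"] w(1,4)[OF z] w(1,4)[OF p] w_mem z v p
        by (simp add: scale_S linear_cmul linear_diff scale0)
    qed
    ultimately show "((\<lambda>s. b0 (w z v) + a0 (z - s *\<^sub>R w z v) - c0 z) \<longlongrightarrow>
        b0 (w e v) + a0 e - c0 e) (at_right 0)"
      by (rule Lim_transform_eventually)
  qed simp
  \<comment> \<open>Both functions are normalized to vanish at \<open>e\<close>, as the logarithmic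
    Cauchy equation requires; the values at \<open>e\<close> become the additive constants.\<close>
  define e0 where "e0 x = a0 x - a0 e" for x
  define f0 where "f0 x = b0 x - b0 e" for x
  \<comment> \<open>This is \<open>a_lim\<close> at \<open>v = e\<close>, where
    \<open>w z e = z\<close>. Substituted back into \<open>a_lim\<close> and \<open>b_lim\<close>,
    it leaves the Cauchy equations for \<open>e0\<close> and \<open>f0\<close>.\<close>
  have c0: "c0 z = e0 z + f0 z + c0 e" if "z \<in> \<Omega>" for z
    using a_lim[OF that p] w(4) that p by (simp add: e0_def f0_def)
  have "w_log_cauchy m e w e0" "w_log_cauchy m e w f0"
    unfolding w_log_cauchy_def \<Omega>_def[symmetric]
    using a_lim b_lim c0 by (auto simp: e0_def f0_def algebra_simps)
  moreover have "continuous_on \<Omega> e0" "continuous_on \<Omega> f0"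
    unfolding e0_def f0_def by (intro continuous_intros cont0)+
  moreover have "a x = inner \<Lambda> x + e0 x + a0 e" "b x = inner \<Lambda> x + f0 x + b0 e" for x
    by (simp_all add: e0_def f0_def a0_def b0_def)
  moreover have "c x = inner \<Lambda> x + e0 x + f0 x + c0 e" if "x \<in> \<Omega>" for x
    using c0[OF that] by (simp add: c0_def)
  moreover have "d u = e0 (w e u) + f0 (e - w e u) + (a0 e + b0 e - c0 e)"
    if "u \<in> \<Omega>" "e - u \<in> \<Omega>" for u
    using d_eq[OF p that] by (simp add: e0_def f0_def)
  ultimately show ?thesis
    unfolding \<Omega>_def[symmetric]
    by (intro exI[of _ "a0 e"] exI[of _ "b0 e"] exI[of _ "c0 e"] exI[of _ "a0 e + b0 e - c0 e"]
        exI[of _ \<Lambda>] exI[of _ e0] exI[of _ f0]) simp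
qed

end
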